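(* The minimum density of a $2$-identifying code of the square grid $G_S$ is at least $6/37$; that is, every $2$-identifying code $C$ of $G_S$ satisfies $D(C)\ge \frac{6}{37}$.
   Context: The square grid $G_S$ is the graph with vertex set $V(G_S)=\mathbb{Z}\times\mathbb{Z}$ and edge set $E(G_S)=\{\{u,v\}: u-v\in\{(0,\pm1),(\pm1,0)\}\}$, subtraction being coordinatewise. For a connected undirected graph $G$ with graph distance $d$, $B_r(v)=\{u\in V(G): d(u,v)\le r\}$. A set $C\subseteq V(G)$ is an $r$-identifying code of $G$ if (1) $B_r(v)\cap C\ne\emptyset$ for every $v\in V(G)$, and (2) $B_r(u)\cap C\neq B_r(v)\cap C$ for all $u\ne v$ in $V(G)$. For a code $C$ in a graph with vertex set $\mathbb{Z}\times\mathbb{Z}$, let $Q_m=\{(x,y)\in\mathbb{Z}\times\mathbb{Z}: |x|\le m,\ |y|\le m\}$; the density of $C$ is $D(C)=\limsup_{m\to\infty}\frac{|C\cap Q_m|}{|Q_m|}$. *)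

theory Defs
  imports
    "HOL-Analysis.Analysis"
    "Graph_Theory.Graph_Theory"
begin

text \<open>
  As usual in the \<open>Graph_Theory\<close> library, an undirected graph is a symmetric digraph: an edge
  \<open>{u, v}\<close> is given by the two arcs \<open>(u, v)\<close> and \<open>(v, u)\<close>.
\<close>

definition square_grid :: "(int \<times> int) pair_pre_digraph" where
  "square_grid = \<lparr> pverts = UNIV,
     parcs = {(u, v). u - v \<in> {(0, 1), (0, - 1), (1, 0), (- 1, 0)}} \<rparr>"

lemma pair_bidirected_digraph_square_grid: "pair_bidirected_digraph square_grid"
  by unfold_locales
     (auto simp: square_grid_def symmetric_def sym_def prod_eq_iff)

text \<open>
  \<open>wf_digraph.\<mu>\<close> is the infimum of the costs of all walks between two vertices; with unit costs it
  is the graph distance (and \<open>\<infinity>\<close> if there is no walk).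
\<close>

definition graph_dist :: "('a, 'b) pre_digraph \<Rightarrow> 'a \<Rightarrow> 'a \<Rightarrow> ereal" where
  "graph_dist G u v = wf_digraph.\<mu> G (\<lambda>_. 1) u v"

definition graph_ball :: "('a, 'b) pre_digraph \<Rightarrow> nat \<Rightarrow> 'a \<Rightarrow> 'a set" where
  "graph_ball G r v = {u \<in> verts G. graph_dist G u v \<le> ereal (real r)}"

definition identifying_code :: "('a, 'b) pre_digraph \<Rightarrow> nat \<Rightarrow> 'a set \<Rightarrow> bool" where
  "identifying_code G r C \<longleftrightarrow>
     C \<subseteq> verts G \<and>
     (\<forall>v \<in> verts G. graph_ball G r v \<inter> C \<noteq> {}) \<and>
     (\<forall>u \<in> verts G. \<forall>v \<in> verts G.
        u \<noteq> v \<longrightarrow> graph_ball G r u \<inter> C \<noteq> graph_ball G r v \<inter> C)"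

definition grid_box :: "nat \<Rightarrow> (int \<times> int) set" where
  "grid_box m = {(x, y). \<bar>x\<bar> \<le> int m \<and> \<bar>y\<bar> \<le> int m}"

text \<open>The limit superior is taken in the extended reals since \<^typ>\<open>real\<close> is not a complete lattice.\<close>

definition code_density :: "(int \<times> int) set \<Rightarrow> ereal" where
  "code_density C =
     limsup (\<lambda>m. ereal (real (card (C \<inter> grid_box m)) / real (card (grid_box m))))"

end

theory Submission
  imports Defs "HOL-Real_Asymp.Real_Asymp"
begin

text \<open>
  Let \<open>I(v)\<close> be the set of codewords within distance 2 of \<open>v\<close>. If every vertex \<open>v\<close> gives each
  codeword of \<open>I(v)\<close> the charge 2, 1/2, 0 or -1/4 according to whether \<open>|I(v)|\<close> is 1, 2, 3 or larger,
  then \<open>|I(v)| (1 + charge) \<ge> 3\<close>. A ball has 13 vertices, so counting the incidences in a large box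
  in two ways shows that the density is at least \<open>3 / (13 + w)\<close> whenever codewords receive at most
  \<open>w\<close> on average; the claim is the case \<open>w = 11/2\<close>.

  For distinct codewords \<open>c\<close> and \<open>x\<close>, at most one vertex has \<open>I(v) = {c, x}\<close>, and no vertex near both
  has \<open>I(v) = {c}\<close>. Hence a codeword with an adjacent codeword receives at most 9/2, and a codeword
  \<open>c\<close> can receive more than 11/2 only if \<open>I(c) = {c}\<close> and eight vertices have \<open>I(v) = {c, x}\<close> for some
  \<open>x\<close>. This forces the four points at distance 3 on the axes through \<open>c\<close> to be codewords, at least two
  of which have an adjacent codeword, and \<open>c\<close> receives at most 6. So \<open>c\<close> can pass 1/4 to
  each of those two, and no codeword gets such a quarter from more than four sides.
\<close>

section \<open>Balls of radius 2 in the square grid\<close>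

definition l1_ball :: "int \<times> int \<Rightarrow> (int \<times> int) set" where
  "l1_ball v = {u. \<bar>fst u - fst v\<bar> + \<bar>snd u - snd v\<bar> \<le> 2}"

lemma mem_l1_ball: "u \<in> l1_ball v \<longleftrightarrow> \<bar>fst u - fst v\<bar> + \<bar>snd u - snd v\<bar> \<le> 2"
  by (simp add: l1_ball_def)

interpretation grid: wf_digraph "with_proj square_grid"
  by unfold_locales (simp_all add: square_grid_def)

lemma verts_grid [simp]: "pverts square_grid = UNIV"
  by (simp add: square_grid_def)

lemma awalk_cost_unit: "grid.awalk_cost (\<lambda>_. 1) p = real (length p)"
  by (induction p) simp_all

lemma parcs_grid: "(u, v) \<in> parcs square_grid \<longleftrightarrow> \<bar>fst u - fst v\<bar> + \<bar>snd u - snd v\<bar> = 1"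
  by (cases u; cases v) (auto simp: square_grid_def)

lemma awalk_length_ge:
  "grid.awalk u p v \<Longrightarrow> \<bar>fst u - fst v\<bar> + \<bar>snd u - snd v\<bar> \<le> int (length p)"
proof (induction p arbitrary: u)
  case Nil
  then show ?case by (simp add: grid.awalk_Nil_iff)
next
  case (Cons e p)
  then have "e \<in> parcs square_grid" "u = fst e" "grid.awalk (snd e) p v"
    by (simp_all add: grid.awalk_Cons_iff)
  with Cons.IH[of "snd e"] parcs_grid[of u "snd e"] show ?case by auto
qed

lemma ex_awalk:
  "\<bar>fst u - fst v\<bar> + \<bar>snd u - snd v\<bar> = int n \<Longrightarrow> \<exists>p. grid.awalk u p v \<and> length p = n"
proof (induction n arbitrary: u)
  case 0
  then have "u = v" by (intro prod_eqI) linarith+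
  then show ?case by (auto simp: grid.awalk_Nil_iff)
next
  case (Suc n)
  \<comment> \<open>\<open>w\<close> is a neighbour of \<open>u\<close> one step closer to
    \<open>v\<close>: the first coordinate is corrected until it agrees, then the second.\<close>
  define w where "w = (if fst u = fst v then (fst u, snd u - sgn (snd u - snd v))
    else (fst u - sgn (fst u - fst v), snd u))"
  have "\<bar>fst w - fst v\<bar> + \<bar>snd w - snd v\<bar> = int n"
    using Suc.prems by (auto simp: w_def sgn_if)
  then obtain p where p: "grid.awalk w p v" "length p = n" using Suc.IH by blast
  have "(u, w) \<in> parcs square_grid"
    using Suc.prems by (auto simp: parcs_grid w_def sgn_if)
  then have "grid.awalk u ((u, w) # p) v" using p by (simp add: grid.awalk_Cons_iff)
  with p(2) show ?case by (metis length_Cons)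
qed

text \<open>No walk is shorter than the l1 distance and some walk attains it. Lengths are integers,
  so outside the ball every walk costs at least 3, and so does the infimum.\<close>

lemma graph_ball_grid: "graph_ball (with_proj square_grid) 2 v = l1_ball v"
proof -
  have "graph_dist (with_proj square_grid) u v \<le> 2 \<longleftrightarrow> u \<in> l1_ball v" for u
  proof
    assume le: "graph_dist (with_proj square_grid) u v \<le> 2"
    show "u \<in> l1_ball v"
    proof (rule ccontr)
      assume "u \<notin> l1_ball v"
      then have "3 \<le> real (length p)" if "grid.awalk u p v" for p
        using awalk_length_ge[OF that] by (simp add: l1_ball_def)
      then have "3 \<le> graph_dist (with_proj square_grid) u v"
        unfolding graph_dist_def grid.\<mu>_def by (intro INF_greatest) (simp add: awalk_cost_unit)
      from order_trans[OF this le] show False by simp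
    qed
  next
    assume u: "u \<in> l1_ball v"
    define n where "n = nat (\<bar>fst u - fst v\<bar> + \<bar>snd u - snd v\<bar>)"
    have n: "\<bar>fst u - fst v\<bar> + \<bar>snd u - snd v\<bar> = int n" "n \<le> 2"
      using u by (simp_all add: n_def l1_ball_def)
    obtain p where "grid.awalk u p v" "length p = n" using ex_awalk[OF n(1)] by blast
    then have "graph_dist (with_proj square_grid) u v \<le> ereal (real n)"
      unfolding graph_dist_def using grid.min_cost_le_walk_cost[of u p v "\<lambda>_. 1"]
      by (simp add: awalk_cost_unit)
    also have "\<dots> \<le> 2" using n(2) by simp
    finally show "graph_dist (with_proj square_grid) u v \<le> 2" .
  qed
  then show ?thesis by (simp add: graph_ball_def)
qed

section \<open>Charges, weights and the discharging rule\<close>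

definition iset :: "(int \<times> int) set \<Rightarrow> int \<times> int \<Rightarrow> (int \<times> int) set" where
  "iset C v = l1_ball v \<inter> C"

definition charge :: "nat \<Rightarrow> real" where
  "charge k = (if k = 1 then 2 else if k = 2 then 1/2 else if k = 3 then 0 else - (1/4))"

definition weight :: "(int \<times> int) set \<Rightarrow> int \<times> int \<Rightarrow> real" where
  "weight C c = (\<Sum>v\<in>l1_ball c. charge (card (iset C v)))"

definition heavy :: "(int \<times> int) set \<Rightarrow> int \<times> int \<Rightarrow> bool" where
  "heavy C c \<longleftrightarrow> c \<in> C \<and> weight C c > 11/2"

definition clustered :: "(int \<times> int) set \<Rightarrow> int \<times> int \<Rightarrow> bool" where
  "clustered C c \<longleftrightarrow> c \<in> C \<and> (\<exists>e\<in>{(1,0),(-1,0),(0,1),(0,-1)}. c + e \<in> C)"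

text \<open>Offsets along which a heavy codeword passes on quarters of its excess.\<close>

definition steps :: "(int \<times> int) set" where
  "steps = {(3,0),(-3,0),(0,3),(0,-3)}"

definition separating :: "(int \<times> int) set \<Rightarrow> bool" where
  "separating C \<longleftrightarrow> (\<forall>v. iset C v \<noteq> {}) \<and> inj (iset C)"

lemma separating_iff: "identifying_code (with_proj square_grid) 2 C \<longleftrightarrow> separating C"
  unfolding identifying_code_def separating_def graph_ball_grid iset_def inj_def
    with_proj_simps verts_grid by blast

lemma l1_ball_0:
  "l1_ball (0, 0) = {(0, 0), (1, 0), (-1, 0), (0, 1), (0, -1), (1, 1), (1, -1), (-1, 1), (-1, -1),
     (2, 0), (-2, 0), (0, 2), (0, -2)}" (is "_ = ?S")
proof (intro equalityI subsetI)
  fix v assume v: "v \<in> l1_ball (0, 0)"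
  obtain p q where pq: "v = (p, q)" by (cases v)
  then have le: "\<bar>p\<bar> + \<bar>q\<bar> \<le> 2" using v by (simp add: l1_ball_def)
  then have "p = -2 \<or> p = -1 \<or> p = 0 \<or> p = 1 \<or> p = 2" by linarith
  moreover have "q = -2 \<or> q = -1 \<or> q = 0 \<or> q = 1 \<or> q = 2" using le by linarith
  ultimately show "v \<in> ?S" using le unfolding pq by (elim disjE) simp_all
qed (auto simp: l1_ball_def)

lemma l1_ball_translate: "l1_ball (a, b) = (\<lambda>(p, q). (a + p, b + q)) ` l1_ball (0, 0)"
proof (intro equalityI subsetI)
  fix v assume "v \<in> l1_ball (a, b)"
  then have "(fst v - a, snd v - b) \<in> l1_ball (0, 0)" by (simp add: l1_ball_def)
  moreover have "v = (\<lambda>(p, q). (a + p, b + q)) (fst v - a, snd v - b)" by simp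
  ultimately show "v \<in> (\<lambda>(p, q). (a + p, b + q)) ` l1_ball (0, 0)" by (rule rev_image_eqI)
qed (auto simp: l1_ball_def)

lemma l1_ball_eq:
  "l1_ball (a, b) = {(a, b), (a + 1, b), (a - 1, b), (a, b + 1), (a, b - 1),
     (a + 1, b + 1), (a + 1, b - 1), (a - 1, b + 1), (a - 1, b - 1),
     (a + 2, b), (a - 2, b), (a, b + 2), (a, b - 2)}"
  by (subst l1_ball_translate) (simp add: l1_ball_0)

lemma finite_l1_ball [simp]: "finite (l1_ball v)"
  by (cases v) (simp add: l1_ball_eq)

lemma finite_iset [simp]: "finite (iset C v)"
  by (simp add: iset_def)

lemma l1_ball_sym: "u \<in> l1_ball v \<longleftrightarrow> v \<in> l1_ball u"
  by (simp add: l1_ball_def abs_minus_commute)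

lemma charge_bounds: "- (1/4) \<le> charge k" "charge k \<le> 2"
  by (simp_all add: charge_def)

text \<open>Equality holds for \<open>k\<close> from 1 to 4, which is where the values of
  \<open>charge\<close> come from; beyond 4 the factor 3/4 stays while \<open>k\<close>
  grows.\<close>

lemma charge_ge: "3 \<le> real k * (1 + charge k)" if "k > 0"
  using that by (auto simp: charge_def)

section \<open>Averages over large boxes\<close>

text \<open>Comparison up to boundary effects: the error, with one \<open>K\<close> for all boxes,
  is linear in the side length and so vanishes against the area.\<close>

definition avg_le :: "(int \<times> int \<Rightarrow> real) \<Rightarrow> (int \<times> int \<Rightarrow> real) \<Rightarrow> bool" where
  "avg_le F G \<longleftrightarrow>
     (\<exists>K. \<forall>m. (\<Sum>v\<in>grid_box m. F v) \<le> (\<Sum>v\<in>grid_box m. G v) + K * (2 * real m + 1))"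

lemma grid_box_eq: "grid_box m = {- int m..int m} \<times> {- int m..int m}"
  by (auto simp: grid_box_def)

lemma finite_grid_box [simp]: "finite (grid_box m)"
  by (simp add: grid_box_eq)

lemma card_grid_box: "card (grid_box m) = (2 * m + 1)\<^sup>2"
  by (simp add: grid_box_eq card_cartesian_product power2_eq_square nat_add_distrib nat_mult_distrib)

lemma avg_le_pointwise: "(\<And>v. F v \<le> G v) \<Longrightarrow> avg_le F G"
  unfolding avg_le_def by (intro exI[of _ 0]) (auto intro: sum_mono)

lemma avg_le_trans [trans]:
  assumes "avg_le F G" "avg_le G H"
  shows "avg_le F H"
proof -
  obtain K L where KL:
    "\<And>m. (\<Sum>v\<in>grid_box m. F v) \<le> (\<Sum>v\<in>grid_box m. G v) + K * (2 * real m + 1)"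
    "\<And>m. (\<Sum>v\<in>grid_box m. G v) \<le> (\<Sum>v\<in>grid_box m. H v) + L * (2 * real m + 1)"
    using assms by (auto simp: avg_le_def)
  have "(\<Sum>v\<in>grid_box m. F v) \<le> (\<Sum>v\<in>grid_box m. H v) + (K + L) * (2 * real m + 1)" for m
    using KL(1)[of m] KL(2)[of m] by (simp add: algebra_simps)
  then show ?thesis by (auto simp: avg_le_def)
qed

lemma avg_le_add:
  assumes "avg_le F G" "avg_le F' G'"
  shows "avg_le (\<lambda>v. F v + F' v) (\<lambda>v. G v + G' v)"
proof -
  obtain K L where KL:
    "\<And>m. (\<Sum>v\<in>grid_box m. F v) \<le> (\<Sum>v\<in>grid_box m. G v) + K * (2 * real m + 1)"
    "\<And>m. (\<Sum>v\<in>grid_box m. F' v) \<le> (\<Sum>v\<in>grid_box m. G' v) + L * (2 * real m + 1)"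
    using assms by (auto simp: avg_le_def)
  have "(\<Sum>v\<in>grid_box m. F v + F' v)
      \<le> (\<Sum>v\<in>grid_box m. G v + G' v) + (K + L) * (2 * real m + 1)" for m
    using KL(1)[of m] KL(2)[of m] by (simp add: sum.distrib algebra_simps)
  then show ?thesis by (auto simp: avg_le_def)
qed

lemma avg_le_sum:
  assumes "finite S" "\<And>d. d \<in> S \<Longrightarrow> avg_le (F d) (G d)"
  shows "avg_le (\<lambda>v. \<Sum>d\<in>S. F d v) (\<lambda>v. \<Sum>d\<in>S. G d v)"
  using assms by (induction S rule: finite_induct) (auto intro: avg_le_pointwise avg_le_add)

lemma avg_le_cancel:
  assumes "avg_le (\<lambda>v. F v + H v) (\<lambda>v. G v + H' v)" "avg_le H' H"
  shows "avg_le F G"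
proof -
  have "avg_le (\<lambda>v. (F v + H v) + H' v) (\<lambda>v. (G v + H' v) + H v)"
    by (rule avg_le_add) (fact assms)+
  then show ?thesis
    by (simp add: avg_le_def sum.distrib)
qed

text \<open>A shifted box lies in the box enlarged by \<open>k\<close>. The added frame has
  \<open>4 * k * (2 * m + k + 1)\<close> points, linear in \<open>m\<close>, and each contributes at
  most \<open>M\<close>.\<close>

lemma avg_le_shift:
  assumes "\<And>v. 0 \<le> F v" "\<And>v. F v \<le> M"
  shows "avg_le (\<lambda>v. F (v + d)) F"
proof -
  define k where "k = nat (max \<bar>fst d\<bar> \<bar>snd d\<bar>)"
  have k: "\<bar>fst d\<bar> \<le> int k" "\<bar>snd d\<bar> \<le> int k" by (auto simp: k_def)
  have "0 \<le> M" using assms order_trans by blast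
  have "(\<Sum>v\<in>grid_box m. F (v + d)) \<le> (\<Sum>v\<in>grid_box m. F v) + M * (4 * k * (k + 1)) * (2 * real m + 1)"
    for m
  proof -
    have sub: "grid_box m \<subseteq> grid_box (m + k)" by (auto simp: grid_box_def)
    have "(\<Sum>v\<in>grid_box m. F (v + d)) = (\<Sum>v\<in>(\<lambda>v. v + d) ` grid_box m. F v)"
      by (simp add: sum.reindex)
    also have "\<dots> \<le> (\<Sum>v\<in>grid_box (m + k). F v)"
    proof (rule sum_mono2)
      show "(\<lambda>v. v + d) ` grid_box m \<subseteq> grid_box (m + k)"
        using k by (cases d) (auto simp: grid_box_def)
    qed (simp_all add: assms)
    also have "\<dots> = (\<Sum>v\<in>grid_box m. F v) + (\<Sum>v\<in>grid_box (m + k) - grid_box m. F v)"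
      using sub by (simp add: sum.subset_diff[of "grid_box m" "grid_box (m + k)"])
    also have "(\<Sum>v\<in>grid_box (m + k) - grid_box m. F v) \<le> real (card (grid_box (m + k) - grid_box m)) * M"
      by (rule sum_bounded_above) (rule assms)
    also have "real (card (grid_box (m + k) - grid_box m)) = (2 * (m + k) + 1)\<^sup>2 - (2 * m + 1)\<^sup>2"
      using sub card_mono[OF _ sub]
      by (simp add: card_Diff_subset of_nat_diff card_grid_box)
    also have "\<dots> \<le> (4 * k * (k + 1)) * (2 * real m + 1)"
      by (simp add: power2_eq_square algebra_simps)
    finally show ?thesis using \<open>0 \<le> M\<close> by (simp add: mult_right_mono mult_ac)
  qed
  then show ?thesis unfolding avg_le_def by blast
qed

text \<open>Dividing by \<open>b\<close> times the area turns the boundary error into a null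
  sequence, and the limit of the lower bounds is below the limit superior.\<close>

lemma code_density_ge:
  assumes "avg_le (\<lambda>_. a) (\<lambda>v. b * of_bool (v \<in> C))" "b > 0"
  shows "code_density C \<ge> ereal (a / b)"
proof -
  obtain K where K: "\<And>m. (\<Sum>v\<in>grid_box m. a)
      \<le> (\<Sum>v\<in>grid_box m. b * of_bool (v \<in> C)) + K * (2 * real m + 1)"
    using assms(1) by (auto simp: avg_le_def)
  let ?D = "\<lambda>m. real (card (C \<inter> grid_box m)) / real (card (grid_box m))"
  have "a / b - K / b / (2 * real m + 1) \<le> ?D m" for m
  proof -
    define n where "n = 2 * real m + 1"
    have "n > 0" by (simp add: n_def)
    have card: "real (card (grid_box m)) = n\<^sup>2"
      by (simp add: card_grid_box n_def add.commute)
    have "n\<^sup>2 * a \<le> b * real (card (C \<inter> grid_box m)) + K * n"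
      using K[of m] by (simp add: card sum_distrib_left[symmetric] Int_commute n_def)
    then have "(n\<^sup>2 * a - K * n) / (b * n\<^sup>2) \<le> b * real (card (C \<inter> grid_box m)) / (b * n\<^sup>2)"
      using \<open>b > 0\<close> by (intro divide_right_mono) auto
    also have "(n\<^sup>2 * a - K * n) / (b * n\<^sup>2) = a / b - K / b / n"
      using \<open>b > 0\<close> \<open>n > 0\<close> by (simp add: field_simps power2_eq_square)
    finally show ?thesis using \<open>b > 0\<close> by (simp add: card n_def)
  qed
  then have le: "limsup (\<lambda>m. ereal (a / b - K / b / (2 * real m + 1))) \<le> code_density C"
    unfolding code_density_def by (intro Limsup_mono always_eventually) auto
  have "(\<lambda>m. a / b - K / b / (2 * real m + 1)) \<longlonglongrightarrow> a / b" by real_asymp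
  then have "limsup (\<lambda>m. ereal (a / b - K / b / (2 * real m + 1))) = ereal (a / b)"
    by (intro lim_imp_Limsup) auto
  with le show ?thesis by simp
qed

text \<open>Incidences between vertices and nearby codewords are counted twice. A vertex collects at
  least 3, a codeword \<open>13 + weight\<close>; by \<open>loc\<close> this averages at most 37/2
  once quarters have been passed on, and 3 / (37/2) = 6/37.\<close>

lemma density_from_discharging:
  assumes sep: "separating C"
  assumes loc: "\<And>c. c \<in> C \<Longrightarrow> weight C c + (\<Sum>d\<in>steps. of_bool (heavy C (c + d) \<and> clustered C c)) / 4
     \<le> 11/2 + (\<Sum>d\<in>steps. of_bool (heavy C c \<and> clustered C (c + d))) / 4"
  shows "code_density C \<ge> ereal (6 / 37)"
proof -
  \<comment> \<open>The amount that \<open>c\<close> passes to \<open>c + d\<close>; what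
    \<open>v\<close> receives from \<open>v + d\<close> is thus
    \<open>send (- d) (v + d)\<close>.\<close>
  define send where "send d c = (of_bool (heavy C c \<and> clustered C (c + d)) / 4 :: real)" for d c
  let ?share = "\<lambda>v. 1 + charge (card (iset C v))"
  let ?B = "l1_ball (0, 0)"
  have shift: "{d \<in> ?B. v + d \<in> C} = (\<lambda>u. u - v) ` iset C v" for v
    by (force simp: iset_def l1_ball_def image_iff)
  have "avg_le (\<lambda>_. 3) (\<lambda>v. \<Sum>d\<in>?B. of_bool (v + d \<in> C) * ?share v)"
  proof (rule avg_le_pointwise)
    fix v
    have "card (iset C v) > 0"
      using sep unfolding separating_def by (simp add: card_gt_0_iff del: split_paired_All)
    then have "3 \<le> real (card (iset C v)) * ?share v" by (rule charge_ge)
    also have "real (card (iset C v)) * ?share v = real (card {d \<in> ?B. v + d \<in> C}) * ?share v"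
      unfolding shift by (simp add: card_image)
    also have "\<dots> = (\<Sum>d\<in>?B. of_bool (v + d \<in> C) * ?share v)"
      by (simp add: sum_distrib_right[symmetric] Int_def)
    finally show "3 \<le> (\<Sum>d\<in>?B. of_bool (v + d \<in> C) * ?share v)" .
  qed
  \<comment> \<open>Change of viewpoint: for each offset \<open>d\<close> the sum is shifted so that
    \<open>v\<close> becomes the codeword instead of the vertex that sees it.\<close>
  also have "avg_le \<dots> (\<lambda>v. \<Sum>d\<in>?B. of_bool (v \<in> C) * ?share (v - d))"
  proof (rule avg_le_sum)
    fix d
    have "avg_le (\<lambda>v. (\<lambda>v. of_bool (v \<in> C) * ?share (v - d)) (v + d))
        (\<lambda>v. of_bool (v \<in> C) * ?share (v - d))"
    proof (rule avg_le_shift)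
      fix v
      show "0 \<le> of_bool (v \<in> C) * ?share (v - d)" "of_bool (v \<in> C) * ?share (v - d) \<le> 3"
        using charge_bounds[of "card (iset C (v - d))"] by auto
    qed
    then show "avg_le (\<lambda>v. of_bool (v + d \<in> C) * ?share v) (\<lambda>v. of_bool (v \<in> C) * ?share (v - d))"
      by simp
  qed simp
  also have "avg_le \<dots> (\<lambda>v. 37/2 * of_bool (v \<in> C))"
  \<comment> \<open>Received quarters are added on the left and sent ones on the right; they cancel
    because everything sent arrives, up to the boundary.\<close>
  proof (rule avg_le_cancel)
    show "avg_le (\<lambda>v. (\<Sum>d\<in>?B. of_bool (v \<in> C) * ?share (v - d)) + (\<Sum>d\<in>steps. send (- d) (v + d)))
      (\<lambda>v. 37/2 * of_bool (v \<in> C) + (\<Sum>d\<in>steps. send d v))"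
    proof (rule avg_le_pointwise)
      fix v
      have "(\<Sum>d\<in>?B. charge (card (iset C (v - d)))) = weight C v"
        unfolding weight_def
        by (rule sum.reindex_bij_witness[of _ "\<lambda>u. v - u" "\<lambda>d. v - d"])
          (auto simp: l1_ball_def abs_minus_commute)
      moreover have "card ?B = 13" by (simp add: l1_ball_eq)
      ultimately have "(\<Sum>d\<in>?B. of_bool (v \<in> C) * ?share (v - d)) = of_bool (v \<in> C) * (13 + weight C v)"
        by (simp add: sum_distrib_left[symmetric] sum.distrib)
      moreover have "send (- d) (v + d) = 0" "send d v = 0" if "v \<notin> C" for d
        using that by (auto simp: send_def heavy_def clustered_def)
      ultimately show "(\<Sum>d\<in>?B. of_bool (v \<in> C) * ?share (v - d)) + (\<Sum>d\<in>steps. send (- d) (v + d))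
          \<le> 37/2 * of_bool (v \<in> C) + (\<Sum>d\<in>steps. send d v)"
        using loc[of v] by (cases "v \<in> C") (simp_all, simp add: send_def sum_divide_distrib)
    qed
    have "avg_le (\<lambda>v. send (- d) v) (\<lambda>v. send (- d) (v + d))" for d
      using avg_le_shift[of "\<lambda>v. send (- d) (v + d)" "1/4" "- d"] by (simp add: send_def)
    then have "avg_le (\<lambda>v. \<Sum>d\<in>steps. send (- d) v) (\<lambda>v. \<Sum>d\<in>steps. send (- d) (v + d))"
      by (intro avg_le_sum) (auto simp: steps_def)
    also have "(\<lambda>v. \<Sum>d\<in>steps. send (- d) v) = (\<lambda>v. \<Sum>d\<in>steps. send d v)"
      by (intro ext sum.reindex_bij_witness[of _ uminus uminus]) (auto simp: steps_def)
    finally show "avg_le (\<lambda>v. \<Sum>d\<in>steps. send d v) (\<lambda>v. \<Sum>d\<in>steps. send (- d) (v + d))" .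
  qed
  finally have "avg_le (\<lambda>_. 3) (\<lambda>v. 37/2 * of_bool (v \<in> C))" .
  from code_density_ge[OF this] show ?thesis by simp
qed

section \<open>Isometries of the grid\<close>

text \<open>\<open>iset\<close> and \<open>weight\<close> see the grid only through balls of radius
  2, so preserving membership in these is what transfers them.\<close>

definition isometry :: "(int \<times> int \<Rightarrow> int \<times> int) \<Rightarrow> bool" where
  "isometry \<phi> \<longleftrightarrow> bij \<phi> \<and> (\<forall>u v. \<phi> u \<in> l1_ball (\<phi> v) \<longleftrightarrow> u \<in> l1_ball v)"

lemma isometry_image_ball: "isometry \<phi> \<Longrightarrow> l1_ball (\<phi> v) = \<phi> ` l1_ball v"
proof (intro equalityI subsetI)
  fix u assume iso: "isometry \<phi>" and u: "u \<in> l1_ball (\<phi> v)"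
  have "surj \<phi>" using iso by (simp add: isometry_def bij_def)
  then obtain w where w: "u = \<phi> w" by (rule surjE)
  then have "w \<in> l1_ball v" using iso u unfolding isometry_def by blast
  with w show "u \<in> \<phi> ` l1_ball v" by (rule rev_image_eqI[rotated])
next
  fix u assume "isometry \<phi>" and "u \<in> \<phi> ` l1_ball v"
  then show "u \<in> l1_ball (\<phi> v)" unfolding isometry_def by blast
qed

lemma iset_vimage: "isometry \<phi> \<Longrightarrow> iset (\<phi> -` C) v = \<phi> -` iset C (\<phi> v)"
  unfolding isometry_def iset_def by blast

lemma card_iset_vimage:
  assumes "isometry \<phi>"
  shows "card (iset (\<phi> -` C) v) = card (iset C (\<phi> v))"
  using assms by (simp add: iset_vimage card_vimage_inj isometry_def bij_def)

lemma separating_vimage: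
  assumes "isometry \<phi>" "separating C"
  shows "separating (\<phi> -` C)"
proof -
  have "bij \<phi>" using assms(1) by (simp add: isometry_def)
  have "iset (\<phi> -` C) v \<noteq> {}" for v
    using assms \<open>bij \<phi>\<close> unfolding separating_def iset_vimage[OF assms(1)]
    by (metis bij_is_surj surj_image_vimage_eq image_empty)
  moreover have "u = v" if "iset (\<phi> -` C) u = iset (\<phi> -` C) v" for u v
  proof -
    have "iset C (\<phi> u) = iset C (\<phi> v)"
      using that \<open>bij \<phi>\<close> unfolding iset_vimage[OF assms(1)]
      by (metis bij_is_surj surj_image_vimage_eq)
    then show ?thesis
      using assms(2) \<open>bij \<phi>\<close> unfolding separating_def by (metis bij_is_inj injD)
  qed
  ultimately show ?thesis by (auto simp: separating_def inj_def simp del: split_paired_All)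
qed

lemma sum_ball_vimage:
  assumes "isometry \<phi>"
  shows "(\<Sum>v\<in>l1_ball c. f (card (iset (\<phi> -` C) v))) = (\<Sum>v\<in>l1_ball (\<phi> c). f (card (iset C v)))"
proof -
  have "inj_on \<phi> (l1_ball c)"
    using assms unfolding isometry_def by (meson bij_is_inj inj_on_subset subset_UNIV)
  then show ?thesis
    unfolding isometry_image_ball[OF assms] card_iset_vimage[OF assms] by (simp add: sum.reindex)
qed

lemma weight_vimage: "isometry \<phi> \<Longrightarrow> weight (\<phi> -` C) c = weight C (\<phi> c)"
  unfolding weight_def by (rule sum_ball_vimage)

lemma isometry_translate: "isometry ((+) a)"
  by (auto simp: isometry_def l1_ball_def bij_plus)

lemma isometry_reflect:
  assumes "\<bar>s\<bar> = 1" "\<bar>t\<bar> = 1"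
  shows "isometry (\<lambda>(x, y). (s * x, t * y))"
proof -
  have "s = 1 \<or> s = -1" "t = 1 \<or> t = -1" using assms by auto
  moreover have "bij (\<lambda>(x, y). (s * x, t * y))"
    using calculation
    by (intro bij_betw_byWitness[where f' = "\<lambda>(x, y). (s * x, t * y)"]) auto
  ultimately show ?thesis by (auto simp: isometry_def l1_ball_def)
qed

lemma isometry_swap: "isometry prod.swap"
  by (auto simp: isometry_def l1_ball_def)

lemma isometry_comp: "isometry \<phi> \<Longrightarrow> isometry \<psi> \<Longrightarrow> isometry (\<phi> \<circ> \<psi>)"
  by (simp add: isometry_def bij_comp del: split_paired_All)

section \<open>Vertices near a codeword\<close>

definition single :: "(int \<times> int) set \<Rightarrow> int \<times> int \<Rightarrow> real" where
  "single C v = of_bool (card (iset C v) = 1)"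

definition pair :: "(int \<times> int) set \<Rightarrow> int \<times> int \<Rightarrow> real" where
  "pair C v = of_bool (card (iset C v) = 2)"

definition big :: "(int \<times> int) set \<Rightarrow> int \<times> int \<Rightarrow> real" where
  "big C v = of_bool (card (iset C v) \<ge> 4)"

abbreviation "B0 \<equiv> l1_ball (0, 0)"

lemmas B0 = l1_ball_0

lemma sum_B0: "(\<Sum>v\<in>B0. f v) = f (0,0) + f (1,0) + f (-1,0) + f (0,1) + f (0,-1)
   + f (1,1) + f (1,-1) + f (-1,1) + f (-1,-1) + f (2,0) + f (-2,0) + f (0,2) + (f (0,-2) :: real)"
  by (simp add: B0)

lemma indicator_bounds:
  "0 \<le> single C v" "0 \<le> pair C v" "0 \<le> big C v" "single C v + pair C v \<le> 1"
  by (auto simp: single_def pair_def big_def)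

lemma card_1_eq: "card A = 1 \<Longrightarrow> a \<in> A \<Longrightarrow> A = {a}"
  by (auto simp: card_1_singleton_iff)

lemma card_2_eq: "card A = 2 \<Longrightarrow> a \<in> A \<Longrightarrow> b \<in> A \<Longrightarrow> a \<noteq> b \<Longrightarrow> A = {a, b}"
  by (auto simp: card_2_iff)

lemma sum_of_bool_le_1:
  assumes "finite A" "\<And>u v. u \<in> A \<Longrightarrow> v \<in> A \<Longrightarrow> P u \<Longrightarrow> P v \<Longrightarrow> u = v"
  shows "(\<Sum>v\<in>A. of_bool (P v) :: real) \<le> 1"
proof -
  have "card {v \<in> A. P v} \<le> Suc 0"
    using assms by (subst card_le_Suc0_iff_eq) auto
  then show ?thesis using assms(1) by (simp add: Int_def)
qed

text \<open>At \<open>k = 0\<close> the two sides would be -1/4 and 0.\<close>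

lemma charge_eq:
  "k \<noteq> 0 \<Longrightarrow> charge k = 2 * of_bool (k = 1) + of_bool (k = 2) / 2 - of_bool (k \<ge> 4) / 4"
  by (auto simp: charge_def)

section \<open>Counting around a codeword placed at the origin\<close>

locale origin_code =
  fixes C :: "(int \<times> int) set"
  assumes sep: "separating C" and origin: "(0, 0) \<in> C"
begin

lemma iset_eqD: "iset C u = iset C v \<Longrightarrow> u = v"
  using sep unfolding separating_def inj_def by blast

lemma origin_in_iset: "v \<in> B0 \<Longrightarrow> (0, 0) \<in> iset C v"
  using origin by (simp add: iset_def l1_ball_sym[of "(0, 0)"])

lemma weight_eq:
  "weight C (0, 0) = 2 * sum (single C) B0 + sum (pair C) B0 / 2 - sum (big C) B0 / 4"
proof -
  have "charge (card (iset C v)) = 2 * single C v + pair C v / 2 - big C v / 4" if "v \<in> B0" for v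
  proof -
    have "card (iset C v) \<noteq> 0" using origin_in_iset[OF that] by auto
    then show ?thesis unfolding single_def pair_def big_def by (rule charge_eq)
  qed
  then show ?thesis
    by (simp add: weight_def sum.distrib sum_subtractf sum_distrib_left sum_divide_distrib)
qed

text \<open>Near the origin a one-element \<open>iset\<close> can only be \<open>{(0, 0)}\<close>,
  and \<open>iset\<close> is injective.\<close>

lemma sum_single_le: "sum (single C) B0 \<le> 1"
  unfolding single_def
proof (rule sum_of_bool_le_1)
  fix u v assume "u \<in> B0" "v \<in> B0" "card (iset C u) = 1" "card (iset C v) = 1"
  then have "iset C u = {(0, 0)}" "iset C v = {(0, 0)}" by (metis card_1_eq origin_in_iset)+
  then show "u = v" by (intro iset_eqD) simp
qed simp

lemma single_iff: "v \<in> B0 \<Longrightarrow> single C v = (if iset C v = {(0, 0)} then 1 else 0)"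
  using card_1_eq[OF _ origin_in_iset, of v]
  by (cases "card (iset C v) = 1") (simp_all add: single_def, force)

text \<open>Both sets would equal \<open>{(0, 0), x}\<close>.\<close>

lemma pair_unique:
  assumes "u \<in> B0" "v \<in> B0" "x \<in> C" "x \<noteq> (0, 0)" "u \<in> l1_ball x" "v \<in> l1_ball x"
    "card (iset C u) = 2" "card (iset C v) = 2"
  shows "u = v"
proof -
  have "x \<in> iset C u" "x \<in> iset C v" using assms by (simp_all add: iset_def l1_ball_sym[of x])
  then have "iset C u = {(0, 0), x}" "iset C v = {(0, 0), x}"
    using assms origin_in_iset by (metis card_2_eq)+
  then show ?thesis by (intro iset_eqD) simp
qed

lemma sum_pair_le:
  assumes "x \<in> C" "x \<noteq> (0, 0)"
  shows "(\<Sum>v\<in>B0. of_bool (v \<in> l1_ball x) * pair C v) \<le> 1"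
proof -
  have "(\<Sum>v\<in>B0. of_bool (v \<in> l1_ball x \<and> card (iset C v) = 2) :: real) \<le> 1"
    using pair_unique[OF _ _ assms] by (intro sum_of_bool_le_1) auto
  then show ?thesis by (simp add: pair_def of_bool_conj)
qed

lemma single_eq_0:
  assumes "x \<in> C" "x \<noteq> (0, 0)" "v \<in> B0" "v \<in> l1_ball x"
  shows "single C v = 0"
proof -
  have "x \<in> iset C v" using assms by (simp add: iset_def l1_ball_sym[of x])
  then have "iset C v \<noteq> {(0, 0)}" using assms(2) by blast
  then show ?thesis by (simp add: single_iff[OF assms(3)])
qed

lemma sum_single_0:
  assumes "x \<in> C" "x \<noteq> (0, 0)"
  shows "(\<Sum>v\<in>B0. of_bool (v \<in> l1_ball x) * single C v) = 0"
  using assms by (intro sum.neutral) (auto simp: single_eq_0[OF assms] simp del: split_paired_All)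

lemma hit:
  assumes "v \<in> B0"
  shows "single C v = 1 \<or> (\<exists>x\<in>l1_ball v. x \<in> C \<and> x \<noteq> (0, 0))"
proof (cases "iset C v = {(0, 0)}")
  case False
  then obtain x where "x \<in> iset C v" "x \<noteq> (0, 0)" using origin_in_iset[OF assms] by blast
  then show ?thesis unfolding iset_def by blast
qed (simp add: single_iff[OF assms])

text \<open>Marks the vertices of positive charge.\<close>

definition low :: "int \<times> int \<Rightarrow> real" where
  "low v = single C v + pair C v"

lemma low_le: "low v \<le> 1"
  by (simp add: low_def indicator_bounds)

lemma sum_low_outside: "sum low (B0 - S) \<le> card (B0 - S)"
  using sum_bounded_above[of "B0 - S" low 1] low_le by simp

text \<open>Among the vertices of \<open>B0\<close> near \<open>x\<close> none sees the origin alone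
  and at most one sees exactly the origin and \<open>x\<close>.\<close>

lemma sum_low_le:
  assumes "x \<in> C" "x \<noteq> (0, 0)"
  shows "sum low B0 \<le> sum low (B0 - l1_ball x) + 1"
proof -
  have "sum low B0 = sum low (B0 \<inter> l1_ball x) + sum low (B0 - l1_ball x)"
    by (rule sum.Int_Diff) simp
  moreover have "sum low (B0 \<inter> l1_ball x) = (\<Sum>v\<in>B0. of_bool (v \<in> l1_ball x) * low v)"
    by (simp add: Int_def)
  moreover have "\<dots> \<le> 1"
    using sum_pair_le[OF assms] sum_single_0[OF assms] by (simp add: low_def distrib_left sum.distrib)
  ultimately show ?thesis by linarith
qed

lemma sum_low_near:
  assumes "x \<in> C" "x \<in> {(1,0),(-1,0),(0,1),(0,-1),(1,1),(1,-1),(-1,1),(-1,-1)}"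
  shows "sum low B0 \<le> 6"
proof -
  have "x \<noteq> (0, 0)" using assms(2) by auto
  moreover have "card (B0 - l1_ball x) = 5"
    using assms(2) unfolding B0 by (elim insertE emptyE) (simp_all add: mem_l1_ball insert_Diff_if)
  ultimately show ?thesis
    using sum_low_le[OF assms(1)] sum_low_outside[of "l1_ball x"] by simp
qed

text \<open>With \<open>s\<close> singles and \<open>p\<close> pairs,
  \<open>2 * s + p / 2 = 3/2 * s + (s + p) / 2\<close>, where \<open>s \<le> 1\<close> and
  \<open>s + p \<le> 6\<close>.\<close>

lemma clustered_weight:
  assumes "clustered C (0, 0)"
  shows "weight C (0, 0) \<le> 9/2"
proof -
  obtain x where "x \<in> C" "x \<in> {(1,0),(-1,0),(0,1),(0,-1)}"
    using assms by (auto simp: clustered_def)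
  then have "sum low B0 \<le> 6" by (intro sum_low_near) auto
  moreover have "sum (big C) B0 \<ge> 0" by (intro sum_nonneg indicator_bounds)
  ultimately show ?thesis using sum_single_le by (simp add: weight_eq low_def sum.distrib)
qed

text \<open>The bound is twice 11/2. As there is at most one single, eight low vertices are
  affordable. The ball of \<open>(2, 0)\<close> contributes at most one and eight vertices lie
  outside it, so one more must be lost, at \<open>(-1, 1)\<close> or
  \<open>(-1, -1)\<close>.\<close>

lemma straight_codeword_bound:
  assumes "(2, 0) \<in> C"
  shows "4 * sum (single C) B0 + sum (pair C) B0 \<le> 11"
proof -
  define Out where "Out = B0 - l1_ball (2, 0)"
  have Out: "Out = {(-1,0), (0,1), (0,-1), (-1,1), (-1,-1), (-2,0), (0,2), (0,-2)}"
    unfolding Out_def B0 by (simp add: mem_l1_ball insert_Diff_if)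
  have out: "sum low B0 \<le> sum low Out + 1"
    unfolding Out_def by (rule sum_low_le) (simp_all add: assms)
  \<comment> \<open>every codeword near \<open>(-1, 1)\<close> or \<open>(-1, -1)\<close> is also near a second vertex of \<open>Out\<close>\<close>
  have le: "sum low B0 \<le> 8" if a: "a \<in> {(-1, 1), (-1, -1)}" and "single C a = 0" for a
  proof -
    have "a \<in> B0" "a \<in> Out" using a by (auto simp: B0 Out)
    from hit[OF this(1)] that(2) obtain y where y: "y \<in> C" "y \<noteq> (0, 0)" "y \<in> l1_ball a"
      by auto
    then obtain u where u: "u \<in> Out" "u \<noteq> a" "u \<in> l1_ball y"
    proof -
      have "\<exists>u\<in>Out. u \<noteq> a \<and> u \<in> l1_ball y"
        using a y(2,3) unfolding Out
        by (elim insertE emptyE; simp only: l1_ball_eq; elim insertE emptyE; simp add: mem_l1_ball)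
      then show ?thesis using that by blast
    qed
    have "u \<in> B0" using u by (simp add: Out_def)
    have "a \<in> l1_ball y" using y(3) by (simp add: l1_ball_sym)
    have "low a + low u \<le> 1"
      using pair_unique[OF \<open>a \<in> B0\<close> \<open>u \<in> B0\<close> y(1,2) \<open>a \<in> l1_ball y\<close> u(3)] u(2)
        single_eq_0[OF y(1,2)] \<open>a \<in> B0\<close> \<open>u \<in> B0\<close> \<open>a \<in> l1_ball y\<close> u(3)
      by (auto simp: low_def pair_def)
    moreover have "sum low Out = low a + sum low (Out - {a})"
      by (rule sum.remove) (simp_all add: \<open>a \<in> Out\<close>, simp add: Out)
    moreover have "sum low (Out - {a}) = low u + sum low (Out - {a} - {u})"
      by (rule sum.remove) (simp_all add: u, simp add: Out)
    moreover have "sum low (Out - {a} - {u}) \<le> 6"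
      using sum_bounded_above[of "Out - {a} - {u}" low 1] low_le \<open>a \<in> Out\<close> u
      by (simp add: card_Diff_singleton_if) (simp add: Out)
    ultimately show ?thesis using out by linarith
  qed
  show ?thesis
  \<comment> \<open>By injectivity these two vertices cannot both see the origin alone.\<close>
  proof (cases "single C (-1, 1) = 0 \<or> single C (-1, -1) = 0")
    case True
    then have "sum low B0 \<le> 8" using le by blast
    then show ?thesis using sum_single_le by (simp add: low_def sum.distrib)
  next
    case False
    then have "iset C (-1, 1) = iset C (-1, -1)" by (simp add: single_iff B0 split: if_splits)
    then show ?thesis using iset_eqD[of "(-1, 1)" "(-1, -1)"] by simp
  qed
qed

lemma weight_le: "weight C (0, 0) \<le> 2 * sum (single C) B0 + sum (pair C) B0 / 2"
  using sum_nonneg[of B0 "big C"] indicator_bounds(3) by (simp add: weight_eq)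

lemma origin_code_vimage:
  assumes "isometry \<phi>" "\<phi> (0, 0) = (0, 0)"
  shows "origin_code (\<phi> -` C)"
  using separating_vimage[OF assms(1) sep] origin assms(2) by unfold_locales simp_all

lemma low_add_le:
  assumes "x \<in> C" "x \<noteq> (0, 0)" "u \<in> B0" "v \<in> B0" "u \<noteq> v" "u \<in> l1_ball x" "v \<in> l1_ball x"
  shows "low u + low v \<le> 1"
  using pair_unique[OF assms(3,4,1,2,6,7)] assms(5) single_eq_0[OF assms(1,2)] assms(3,4,6,7)
  by (auto simp: low_def pair_def)

text \<open>A second codeword in \<open>B0\<close> is either one of the eight nearest points,
  leaving at most six low vertices, or a tip, which a symmetry fixing the origin moves to
  \<open>(2, 0)\<close>.\<close>

lemma noncentral_weight:
  assumes "iset C (0, 0) \<noteq> {(0, 0)}"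
  shows "weight C (0, 0) \<le> 11/2"
proof -
  have "(0, 0) \<in> iset C (0, 0)" by (rule origin_in_iset) (simp add: B0)
  then obtain x where "x \<in> iset C (0, 0)" "x \<noteq> (0, 0)" using assms by blast
  then have x: "x \<in> C" "x \<in> B0" "x \<noteq> (0, 0)" by (simp_all add: iset_def)
  show ?thesis
  proof (cases "x \<in> {(2, 0), (-2, 0), (0, 2), (0, -2)}")
    case False
    then have "x \<in> {(1,0),(-1,0),(0,1),(0,-1),(1,1),(1,-1),(-1,1),(-1,-1)}"
      using x(2,3) unfolding B0 by blast
    then have "sum low B0 \<le> 6" using sum_low_near x(1) by blast
    then show ?thesis using weight_le sum_single_le by (simp add: low_def sum.distrib)
  next
    case True
    have "\<exists>\<phi>. isometry \<phi> \<and> \<phi> (0, 0) = (0, 0) \<and> \<phi> (2, 0) = x"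
    proof -
      have r: "isometry (\<lambda>(x, y). (s * x, y))" if "\<bar>s\<bar> = 1" for s
        using isometry_reflect[OF that, of 1] by simp
      have r': "isometry (\<lambda>(x, y). (y, s * x))" if "\<bar>s\<bar> = 1" for s
        using isometry_comp[OF isometry_swap r[OF that]] by (simp add: comp_def split_def prod.swap_def)
      show ?thesis
        using True
      proof (elim insertE emptyE)
        assume "x = (2, 0)"
        then show ?thesis using r[of 1] by (intro exI[of _ "\<lambda>(x, y). (1 * x, y)"]) simp
      next
        assume "x = (-2, 0)"
        then show ?thesis using r[of "-1"] by (intro exI[of _ "\<lambda>(x, y). (-1 * x, y)"]) simp
      next
        assume "x = (0, 2)"
        then show ?thesis using r'[of 1] by (intro exI[of _ "\<lambda>(x, y). (y, 1 * x)"]) simp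
      next
        assume "x = (0, -2)"
        then show ?thesis using r'[of "-1"] by (intro exI[of _ "\<lambda>(x, y). (y, -1 * x)"]) simp
      qed
    qed
    then obtain \<phi> where \<phi>: "isometry \<phi>" "\<phi> (0, 0) = (0, 0)" "\<phi> (2, 0) = x" by blast
    interpret im: origin_code "\<phi> -` C" by (rule origin_code_vimage) fact+
    have "(2, 0) \<in> \<phi> -` C" using \<phi>(3) x(1) by simp
    from im.straight_codeword_bound[OF this] im.weight_le have "weight (\<phi> -` C) (0, 0) \<le> 11/2" by simp
    then show ?thesis using weight_vimage[OF \<phi>(1), of C "(0, 0)"] \<phi>(2) by simp
  qed
qed

end

section \<open>Codewords without other codewords nearby\<close>

text \<open>The case left over: with at most seven pairs the weight is at most 2 + 7/2 =
  11/2.\<close>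

locale central_code = origin_code +
  assumes central: "iset C (0, 0) = {(0, 0)}" and many_pairs: "sum (pair C) B0 > 7"
begin

lemma central_code_vimage:
  assumes "isometry \<phi>" "\<phi> (0, 0) = (0, 0)"
  shows "central_code (\<phi> -` C)"
proof -
  interpret im: origin_code "\<phi> -` C" by (rule origin_code_vimage) fact+
  have "single (\<phi> -` C) (0, 0) = 1"
    using central assms by (simp add: single_def card_iset_vimage)
  then have "iset (\<phi> -` C) (0, 0) = {(0, 0)}"
    by (simp add: im.single_iff B0 split: if_splits)
  moreover have "sum (pair (\<phi> -` C)) B0 = sum (pair C) B0"
    unfolding pair_def
    by (rule sum_ball_vimage[OF assms(1), of "\<lambda>k. of_bool (k = 2)" C "(0, 0)", unfolded assms(2)])
  ultimately show ?thesis using many_pairs by unfold_locales simp_all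
qed

lemma near_empty: "x \<in> B0 \<Longrightarrow> x \<noteq> (0, 0) \<Longrightarrow> x \<notin> C"
  using central unfolding iset_def by blast

lemma single_0: "v \<in> B0 \<Longrightarrow> v \<noteq> (0, 0) \<Longrightarrow> single C v = 0"
  using iset_eqD[of v "(0, 0)"] by (auto simp: single_iff central)

text \<open>The origin already has the \<open>iset\<close> \<open>{(0, 0)}\<close>, so every other
  vertex of \<open>B0\<close> sees a second codeword, and \<open>B0\<close> holds none.\<close>

lemma central_hit: "v \<in> B0 \<Longrightarrow> v \<noteq> (0, 0) \<Longrightarrow> \<exists>x\<in>l1_ball v - B0. x \<in> C"
  using hit[of v] single_0[of v] near_empty by force

lemma sum_low_gt: "sum low B0 > 8"
proof -
  have "single C (0, 0) \<le> sum (single C) B0"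
    by (rule member_le_sum) (simp_all add: B0 indicator_bounds)
  moreover have "single C (0, 0) = 1" using central by (simp add: single_def)
  ultimately show ?thesis using many_pairs by (simp add: low_def sum.distrib)
qed

section \<open>Locating the codewords just outside \<open>B0\<close>\<close>

lemma hit_1_0: "(3,0) \<in> C \<or> (2,1) \<in> C \<or> (2,-1) \<in> C \<or> (1,2) \<in> C \<or> (1,-2) \<in> C"
  using central_hit[of "(1,0)"] unfolding l1_ball_eq by simp blast

lemma hit_0_1: "(0,3) \<in> C \<or> (1,2) \<in> C \<or> (-1,2) \<in> C \<or> (2,1) \<in> C \<or> (-2,1) \<in> C"
  using central_hit[of "(0,1)"] unfolding l1_ball_eq by simp blast

lemma hit_m1_0: "(-3,0) \<in> C \<or> (-2,1) \<in> C \<or> (-2,-1) \<in> C \<or> (-1,2) \<in> C \<or> (-1,-2) \<in> C"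
  using central_hit[of "(-1,0)"] unfolding l1_ball_eq by simp blast

lemma hit_0_m1: "(0,-3) \<in> C \<or> (1,-2) \<in> C \<or> (-1,-2) \<in> C \<or> (2,-1) \<in> C \<or> (-2,-1) \<in> C"
  using central_hit[of "(0,-1)"] unfolding l1_ball_eq by simp blast

lemma hit_1_1: "(2,2) \<in> C \<or> (1,3) \<in> C \<or> (3,1) \<in> C \<or> (1,2) \<in> C \<or> (2,1) \<in> C"
  using central_hit[of "(1,1)"] unfolding l1_ball_eq by simp blast

lemma hit_m1_1: "(-2,2) \<in> C \<or> (-1,3) \<in> C \<or> (-3,1) \<in> C \<or> (-1,2) \<in> C \<or> (-2,1) \<in> C"
  using central_hit[of "(-1,1)"] unfolding l1_ball_eq by simp blast

lemma hit_1_m1: "(2,-2) \<in> C \<or> (1,-3) \<in> C \<or> (3,-1) \<in> C \<or> (1,-2) \<in> C \<or> (2,-1) \<in> C"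
  using central_hit[of "(1,-1)"] unfolding l1_ball_eq by simp blast

lemma hit_m1_m1: "(-2,-2) \<in> C \<or> (-1,-3) \<in> C \<or> (-3,-1) \<in> C \<or> (-1,-2) \<in> C \<or> (-2,-1) \<in> C"
  using central_hit[of "(-1,-1)"] unfolding l1_ball_eq by simp blast

text \<open>The ball of \<open>(2, 1)\<close> misses nine vertices of \<open>B0\<close>, whose
  \<open>low\<close> values must total more than 7. Two disjoint pairs of them, each containing at
  most one low vertex, would leave only 2 + 5.\<close>

lemma no_2_1: "(2, 1) \<notin> C"
proof
  assume "(2, 1) \<in> C"
  have "B0 - l1_ball (2, 1) = {(0,0), (-1,0), (0,-1), (1,-1), (-1,1), (-1,-1), (-2,0), (0,2), (0,-2)}"
    unfolding B0 by (simp add: mem_l1_ball insert_Diff_if)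
  then have sum: "low (0,0) + low (-1,0) + low (0,-1) + low (1,-1) + low (-1,1) + low (-1,-1)
      + low (-2,0) + low (0,2) + low (0,-2) > 7"
    using sum_low_le[OF \<open>(2, 1) \<in> C\<close>] sum_low_gt by simp
  have add_le: "low u + low v \<le> 1"
    if "x \<in> C" "x \<noteq> (0, 0)" "u \<in> B0 \<and> v \<in> B0 \<and> u \<noteq> v \<and> u \<in> l1_ball x \<and> v \<in> l1_ball x" for x u v
    using low_add_le that by blast
  note le = low_le[of "(0,0)"] low_le[of "(-1,0)"] low_le[of "(0,-1)"] low_le[of "(1,-1)"]
    low_le[of "(-1,1)"] low_le[of "(-1,-1)"] low_le[of "(-2,0)"] low_le[of "(0,2)"] low_le[of "(0,-2)"]
  have 1: "(-1,-2) \<notin> C"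
  proof
    assume "(-1,-2) \<in> C"
    from add_le[OF this, of "(-1,0)" "(0,-1)"] add_le[OF this, of "(-1,-1)" "(0,-2)"] sum le
    show False by (simp add: mem_l1_ball)
  qed
  have 2: "(-2,-1) \<notin> C"
  proof
    assume "(-2,-1) \<in> C"
    from add_le[OF this, of "(-1,0)" "(-2,0)"] add_le[OF this, of "(-1,-1)" "(0,-1)"] sum le
    show False by (simp add: mem_l1_ball)
  qed
  \<comment> \<open>With \<open>(-1,-2)\<close> and \<open>(-2,-1)\<close> excluded, the codewords
    seen from \<open>(-1,0)\<close> and \<open>(0,-1)\<close> yield one pair each, and these pairs
    are disjoint.\<close>
  have west: "low (-1,0) + low (-2,0) \<le> 1 \<or> low (-1,0) + low (-1,1) \<le> 1"
    using hit_m1_0 1 2 add_le[of _ "(-1,0)" "(-2,0)"] add_le[of "(-1,2)" "(-1,0)" "(-1,1)"]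
    by (auto simp: mem_l1_ball)
  have south: "low (0,-1) + low (0,-2) \<le> 1 \<or> low (0,-1) + low (1,-1) \<le> 1"
    using hit_0_m1 1 2 add_le[of _ "(0,-1)" "(0,-2)"] add_le[of "(2,-1)" "(0,-1)" "(1,-1)"]
    by (auto simp: mem_l1_ball)
  show False using west south sum le by linarith
qed

text \<open>Reflections and the coordinate swap carry \<open>(2, 1)\<close> to all eight
  points.\<close>

lemma no_knight: "x \<in> {(2,1), (2,-1), (-2,1), (-2,-1), (1,2), (1,-2), (-1,2), (-1,-2)} \<Longrightarrow> x \<notin> C"
proof -
  have no: "\<phi> (2, 1) \<notin> C" if "isometry \<phi>" "\<phi> (0, 0) = (0, 0)" for \<phi>
  proof -
    interpret im: central_code "\<phi> -` C" by (rule central_code_vimage) fact+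
    show ?thesis using im.no_2_1 by simp
  qed
  have "(2 * s, t) \<notin> C" "(t, 2 * s) \<notin> C" if "\<bar>s\<bar> = 1" "\<bar>t\<bar> = 1" for s t
    using no[OF isometry_reflect[OF that]] no[OF isometry_comp[OF isometry_swap isometry_reflect[OF that]]]
    by (simp_all add: mult.commute)
  from this[of 1 1] this[of 1 "-1"] this[of "-1" 1] this[of "-1" "-1"]
  show "x \<in> {(2,1), (2,-1), (-2,1), (-2,-1), (1,2), (1,-2), (-1,2), (-1,-2)} \<Longrightarrow> x \<notin> C" by auto
qed

lemma axis: "(3,0) \<in> C" "(-3,0) \<in> C" "(0,3) \<in> C" "(0,-3) \<in> C"
  using hit_1_0 hit_m1_0 hit_0_1 hit_0_m1 no_knight by simp_all

text \<open>Each axis codeword allows one low vertex among two on its arm. With the four diagonal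
  vertices and the origin this makes nine, and the origin is a single.\<close>

lemma sum_pair_le_8: "sum (pair C) B0 \<le> 8"
proof -
  have add_le: "low u + low v \<le> 1"
    if "x \<in> C" "x \<noteq> (0, 0)" "u \<in> B0 \<and> v \<in> B0 \<and> u \<noteq> v \<and> u \<in> l1_ball x \<and> v \<in> l1_ball x" for x u v
    using low_add_le that by blast
  have "low (1,0) + low (2,0) \<le> 1" "low (-1,0) + low (-2,0) \<le> 1"
    "low (0,1) + low (0,2) \<le> 1" "low (0,-1) + low (0,-2) \<le> 1"
    by (rule axis[THEN add_le]; simp add: mem_l1_ball)+
  then have "sum low B0 \<le> 9"
    using low_le[of "(1,1)"] low_le[of "(1,-1)"] low_le[of "(-1,1)"] low_le[of "(-1,-1)"] low_le[of "(0,0)"]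
    by (simp add: sum_B0)
  moreover have "single C (0, 0) \<le> sum (single C) B0"
    by (rule member_le_sum) (simp_all add: B0 indicator_bounds)
  moreover have "single C (0, 0) = 1" using central by (simp add: single_def)
  ultimately show ?thesis by (simp add: low_def sum.distrib)
qed

lemma big_intro:
  assumes "v \<in> B0" "card {x, y, z} = 3" "{x, y, z} \<subseteq> l1_ball v \<inter> C - {(0, 0)}"
  shows "big C v = 1"
proof -
  have "card (insert (0, 0) {x, y, z}) \<le> card (iset C v)"
    using assms origin_in_iset[OF assms(1)] by (intro card_mono) (auto simp: iset_def)
  moreover have "card (insert (0, 0) {x, y, z}) = 4"
    using assms(2,3) by (subst card_insert_disjoint) auto
  ultimately show ?thesis by (simp add: big_def)
qed

text \<open>Each diagonal neighbour of the origin forces a codeword in its quadrant. Next to an axis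
  codeword it makes that one clustered; two suitable ones make a tip of \<open>B0\<close> see four
  codewords. Two such tips lower the bound 6 by 1/2.\<close>

lemma weight_or_clustered:
  "weight C (0, 0) \<le> 11/2 \<or>
   weight C (0, 0) \<le> 6 \<and> (\<Sum>d\<in>steps. of_bool (clustered C d)) \<ge> (2 :: real)"
proof -
  define bE bW bN bS where "bE \<longleftrightarrow> big C (2,0) = 1" and "bW \<longleftrightarrow> big C (-2,0) = 1"
    and "bN \<longleftrightarrow> big C (0,2) = 1" and "bS \<longleftrightarrow> big C (0,-2) = 1"
  note b_defs = bE_def bW_def bN_def bS_def
  define cE cW cN cS where "cE \<longleftrightarrow> clustered C (3,0)" and "cW \<longleftrightarrow> clustered C (-3,0)"
    and "cN \<longleftrightarrow> clustered C (0,3)" and "cS \<longleftrightarrow> clustered C (0,-3)"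
  note c_defs = cE_def cW_def cN_def cS_def
  have diag:
    "(2,2) \<in> C \<or> (1,3) \<in> C \<or> (3,1) \<in> C" "(-2,2) \<in> C \<or> (-1,3) \<in> C \<or> (-3,1) \<in> C"
    "(2,-2) \<in> C \<or> (1,-3) \<in> C \<or> (3,-1) \<in> C" "(-2,-2) \<in> C \<or> (-1,-3) \<in> C \<or> (-3,-1) \<in> C"
    using hit_1_1 hit_m1_1 hit_1_m1 hit_m1_m1 no_knight by simp_all
  have c: "(3,1) \<in> C \<or> (3,-1) \<in> C \<Longrightarrow> cE" "(-3,1) \<in> C \<or> (-3,-1) \<in> C \<Longrightarrow> cW"
    "(1,3) \<in> C \<or> (-1,3) \<in> C \<Longrightarrow> cN" "(1,-3) \<in> C \<or> (-1,-3) \<in> C \<Longrightarrow> cS"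
    using axis by (auto simp: c_defs clustered_def)
  have b: "(2,2) \<in> C \<and> (2,-2) \<in> C \<Longrightarrow> bE" "(3,1) \<in> C \<and> (3,-1) \<in> C \<Longrightarrow> bE"
    "(-2,2) \<in> C \<and> (-2,-2) \<in> C \<Longrightarrow> bW" "(-3,1) \<in> C \<and> (-3,-1) \<in> C \<Longrightarrow> bW"
    "(2,2) \<in> C \<and> (-2,2) \<in> C \<Longrightarrow> bN" "(1,3) \<in> C \<and> (-1,3) \<in> C \<Longrightarrow> bN"
    "(2,-2) \<in> C \<and> (-2,-2) \<in> C \<Longrightarrow> bS" "(1,-3) \<in> C \<and> (-1,-3) \<in> C \<Longrightarrow> bS"
    using axis big_intro[of "(2,0)" "(3,0)" "(2,2)" "(2,-2)"] big_intro[of "(2,0)" "(3,0)" "(3,1)" "(3,-1)"]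
      big_intro[of "(-2,0)" "(-3,0)" "(-2,2)" "(-2,-2)"] big_intro[of "(-2,0)" "(-3,0)" "(-3,1)" "(-3,-1)"]
      big_intro[of "(0,2)" "(0,3)" "(2,2)" "(-2,2)"] big_intro[of "(0,2)" "(0,3)" "(1,3)" "(-1,3)"]
      big_intro[of "(0,-2)" "(0,-3)" "(2,-2)" "(-2,-2)"] big_intro[of "(0,-2)" "(0,-3)" "(1,-3)" "(-1,-3)"]
    unfolding b_defs by (simp_all add: mem_l1_ball)
  \<comment> \<open>If no axis codeword is clustered, all points \<open>(2,2)\<close>,
    \<open>(-2,2)\<close>, \<open>(2,-2)\<close>, \<open>(-2,-2)\<close> are codewords and all tips
    big. If only the east one is, the west tip is big; so is the east tip when \<open>(3,1)\<close>
    and \<open>(3,-1)\<close> are codewords, and otherwise the north or south tip.\<close>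
  have "(cE \<and> cW \<or> cE \<and> cN \<or> cE \<and> cS \<or> cW \<and> cN \<or> cW \<and> cS \<or> cN \<and> cS)
      \<or> (bE \<and> bW \<or> bE \<and> bN \<or> bE \<and> bS \<or> bW \<and> bN \<or> bW \<and> bS \<or> bN \<and> bS)"
    using diag c b by argo
  then show ?thesis
  proof
    assume *: "cE \<and> cW \<or> cE \<and> cN \<or> cE \<and> cS \<or> cW \<and> cN \<or> cW \<and> cS \<or> cN \<and> cS"
    have "(\<Sum>d\<in>steps. of_bool (clustered C d) :: real) = of_bool cE + of_bool cW + of_bool cN + of_bool cS"
      by (simp add: steps_def c_defs)
    also have "\<dots> \<ge> 2" using * by auto
    finally have "(\<Sum>d\<in>steps. of_bool (clustered C d) :: real) \<ge> 2" by simp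
    moreover have "weight C (0, 0) \<le> 6" using weight_le sum_single_le sum_pair_le_8 by simp
    ultimately show ?thesis by simp
  next
    assume *: "bE \<and> bW \<or> bE \<and> bN \<or> bE \<and> bS \<or> bW \<and> bN \<or> bW \<and> bS \<or> bN \<and> bS"
    have "sum (big C) {(2,0), (-2,0), (0,2), (0,-2)} \<le> sum (big C) B0"
      by (rule sum_mono2) (auto simp: B0 indicator_bounds)
    moreover have "sum (big C) {(2,0), (-2,0), (0,2), (0,-2)} \<ge> 2"
      using * indicator_bounds(3)[of C "(2,0)"] indicator_bounds(3)[of C "(-2,0)"] indicator_bounds(3)[of C "(0,2)"] indicator_bounds(3)[of C "(0,-2)"]
      unfolding b_defs by (elim disjE conjE) simp_all
    ultimately show ?thesis using sum_single_le sum_pair_le_8 by (simp add: weight_eq)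
  qed
qed

end

section \<open>Discharging\<close>

lemma (in origin_code) origin_weight:
  "weight C (0, 0) \<le> 11/2 \<or>
   weight C (0, 0) \<le> 6 \<and> (\<Sum>d\<in>steps. of_bool (clustered C d)) \<ge> (2 :: real)"
proof (cases "iset C (0, 0) = {(0, 0)} \<and> sum (pair C) B0 > 7")
  case True
  then interpret central_code C by unfold_locales simp_all
  show ?thesis by (rule weight_or_clustered)
next
  case False
  then have "weight C (0, 0) \<le> 11/2"
    using noncentral_weight weight_le sum_single_le by fastforce
  then show ?thesis ..
qed

text \<open>After translating \<open>c\<close> to the origin: a clustered codeword has 9/2 and
  receives at most four quarters; any other receives nothing, and a heavy one has at most 6 and
  gives away at least two quarters.\<close>

lemma discharging:
  assumes "separating C" "c \<in> C"
  shows "weight C c + (\<Sum>d\<in>steps. of_bool (heavy C (c + d) \<and> clustered C c)) / 4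
     \<le> 11/2 + (\<Sum>d\<in>steps. of_bool (heavy C c \<and> clustered C (c + d))) / 4"
proof -
  interpret t: origin_code "(+) c -` C"
    using separating_vimage[OF isometry_translate assms(1), of c] assms(2)
    by unfold_locales (simp_all add: zero_prod_def[symmetric])
  have w: "weight ((+) c -` C) (0, 0) = weight C c"
    by (simp add: weight_vimage[OF isometry_translate] zero_prod_def[symmetric])
  have cl: "clustered ((+) c -` C) d \<longleftrightarrow> clustered C (c + d)" for d
    by (simp add: clustered_def add.assoc)
  have nonneg: "(\<Sum>d\<in>steps. of_bool (heavy C c \<and> clustered C (c + d)) :: real) \<ge> 0"
    by (intro sum_nonneg) simp
  show ?thesis
  proof (cases "clustered C c")
    case True
    then have "weight C c \<le> 9/2"
      using t.clustered_weight cl[of "(0, 0)"] w by (simp add: zero_prod_def[symmetric])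
    moreover have "(\<Sum>d\<in>steps. of_bool (heavy C (c + d) \<and> clustered C c) :: real) \<le> 4"
      using sum_bounded_above[of steps "\<lambda>d. of_bool (heavy C (c + d) \<and> clustered C c) :: real" 1]
      by (simp add: steps_def)
    ultimately show ?thesis using nonneg by linarith
  next
    case False
    show ?thesis
    proof (cases "weight C c \<le> 11/2")
      case True
      then show ?thesis using False nonneg by simp
    next
      case big: False
      then have "heavy C c" using assms(2) by (simp add: heavy_def)
      then show ?thesis using t.origin_weight False big by (simp add: w cl)
    qed
  qed
qed

theorem theorem3:
  fixes C :: "(int \<times> int) set"
  assumes "identifying_code (with_proj square_grid) 2 C"
  shows "code_density C \<ge> ereal (6 / 37)"
  using assms density_from_discharging discharging unfolding separating_iff by blast

end
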